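(* Let $(\mathcal{X},\mathcal{A},L)$ be a basic game, $t:\mathcal{X}\to\mathbb{R}^k$ a statistic with $T=t(X)$, and, for $\tau\in\mathbb{R}^k$, $\Gamma_\tau:=\{P\in\mathcal{P}:E_P(T)=\tau\}$. Suppose that $\tau\in\mathcal{T}^0$ and $(P_\tau,\zeta_\tau)$ is a saddle-point for the game $\mathcal{G}^\tau=(\Gamma_\tau,\mathcal{A},L)$. If $t(x)\in\mathcal{T}$ for all $x\in\mathcal{X}$, then $\tau$ is regular.
   Context: A basic game $(\mathcal{X},\mathcal{A},L)$ consists of measurable spaces $\mathcal{X}$ and $\mathcal{A}$ (with $\sigma$-fields containing all singletons) and a jointly measurable loss function $L:\mathcal{X}\times\mathcal{A}\to(-\infty,\infty]$. Expectations are taken in the extended sense $E f=E f^+-E f^-$, defined unless both terms are infinite. $L(P,a):=E_P\{L(X,a)\}$, and $\mathcal{P}$ is the set of all probability distributions $P$ on $\mathcal{X}$ such that $L(P,a)$ is defined for all $a\in\mathcal{A}$. For a randomized act $\zeta$ (a probability distribution on $\mathcal{A}$), $L(x,\zeta):=E_{A\sim\zeta}\{L(x,A)\}$ and $L(P,\zeta):=E_{(X,A)\sim P\times\zeta}\{L(X,A)\}$; $\mathcal{Z}$ is the set of all $\zeta$ such that $L(P,\zeta)$ is defined for all $P\in\mathcal{P}$. The generalized entropy is $H(P):=\inf_{a\in\mathcal{A}}L(P,a)$. Specific entropy: $h(\tau):=\sup_{P\in\Gamma_\tau}H(P)$ (with $h(\tau)=-\infty$ if $\Gamma_\tau=\varnothing$);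 $\mathcal{T}:=\{\tau\in\mathbb{R}^k:h(\tau)>-\infty\}$, which is a convex set, with relative interior $\mathcal{T}^0$; $\mathcal{P}^*:=\{P\in\mathcal{P}:E_P(T)\in\mathcal{T}\}$. A pair $(P_\tau,\zeta_\tau)\in\Gamma_\tau\times\mathcal{Z}$ is a saddle-point in $\mathcal{G}^\tau$ if $L(P_\tau,\zeta_\tau)$ is finite, $L(P_\tau,\zeta_\tau)\le L(P_\tau,\zeta)$ for all $\zeta\in\mathcal{Z}$, and $L(P_\tau,\zeta_\tau)\ge L(P,\zeta_\tau)$ for all $P\in\Gamma_\tau$. A point $\tau\in\mathcal{T}$ is regular if there exist a saddle-point $(P_\tau,\zeta_\tau)$ in $\mathcal{G}^\tau$ and $\beta\in\mathbb{R}^k$ such that: (i) $P_\tau$ attains $\sup_{P\in\mathcal{P}^*}\{H(P)-\beta^{\mathrm T}E_P(T)\}$, this supremum being finite; and (ii) with $\beta_0:=h(\tau)-\beta^{\mathrm T}\tau$, the equality $L(X,\zeta_\tau)=\beta_0+\beta^{\mathrm T}t(X)$ holds with $P_\tau$-probability $1$. *)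

theory Defs
  imports "HOL-Probability.Probability"
begin

text \<open>Extended expectation \<open>E f = E f\<^sup>+ - E f\<^sup>-\<close>. The function \<open>e2ennreal\<close> truncates negative
  values to \<open>0\<close>, so the two integrals below are those of the positive and negative part.
  In \<open>ereal\<close> one has \<open>\<infinity> - \<infinity> = \<infinity>\<close>; the value is meaningful only where the expectation is defined.\<close>

definition ext_expectation_defined :: "'c measure \<Rightarrow> ('c \<Rightarrow> ereal) \<Rightarrow> bool" where
  "ext_expectation_defined M f \<longleftrightarrow>
     \<not> ((\<integral>\<^sup>+ x. e2ennreal (f x) \<partial>M) = \<infinity> \<and> (\<integral>\<^sup>+ x. e2ennreal (- f x) \<partial>M) = \<infinity>)"

definition ext_expectation :: "'c measure \<Rightarrow> ('c \<Rightarrow> ereal) \<Rightarrow> ereal" where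
  "ext_expectation M f =
     enn2ereal (\<integral>\<^sup>+ x. e2ennreal (f x) \<partial>M) - enn2ereal (\<integral>\<^sup>+ x. e2ennreal (- f x) \<partial>M)"

locale basic_game =
  fixes X :: "'x measure" and A :: "'a measure" and L :: "'x \<Rightarrow> 'a \<Rightarrow> ereal"
  assumes singleton_X: "x \<in> space X \<Longrightarrow> {x} \<in> sets X"
    and singleton_A: "a \<in> space A \<Longrightarrow> {a} \<in> sets A"
    and loss_measurable: "(\<lambda>(x, a). L x a) \<in> borel_measurable (X \<Otimes>\<^sub>M A)"
    and loss_gt_minus_infinity: "\<lbrakk>x \<in> space X; a \<in> space A\<rbrakk> \<Longrightarrow> L x a > -\<infinity>"
begin

definition loss_act :: "'x measure \<Rightarrow> 'a \<Rightarrow> ereal" where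
  "loss_act P a = ext_expectation P (\<lambda>x. L x a)"

definition dists :: "'x measure set" where
  "dists = {P. prob_space P \<and> sets P = sets X \<and>
     (\<forall>a\<in>space A. ext_expectation_defined P (\<lambda>x. L x a))}"

definition loss_at_rand :: "'x \<Rightarrow> 'a measure \<Rightarrow> ereal" where
  "loss_at_rand x \<zeta> = ext_expectation \<zeta> (\<lambda>a. L x a)"

definition loss_rand :: "'x measure \<Rightarrow> 'a measure \<Rightarrow> ereal" where
  "loss_rand P \<zeta> = ext_expectation (P \<Otimes>\<^sub>M \<zeta>) (\<lambda>(x, a). L x a)"

definition rand_acts :: "'a measure set" where
  "rand_acts = {\<zeta>. prob_space \<zeta> \<and> sets \<zeta> = sets A \<and>
     (\<forall>P\<in>dists. ext_expectation_defined (P \<Otimes>\<^sub>M \<zeta>) (\<lambda>(x, a). L x a))}"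

definition entropy :: "'x measure \<Rightarrow> ereal" where
  "entropy P = (INF a\<in>space A. loss_act P a)"

end

locale basic_game_statistic = basic_game X A L
  for X :: "'x measure" and A :: "'a measure" and L :: "'x \<Rightarrow> 'a \<Rightarrow> ereal" +
  fixes t :: "'x \<Rightarrow> real ^ 'k"
  assumes statistic_measurable: "t \<in> borel_measurable X"
begin

text \<open>The Bochner integral of a non-integrable function is \<open>0\<close> by convention, hence the explicit
  integrability conditions wherever \<open>E\<^sub>P(T)\<close> is required to be a point of \<open>\<real>\<^sup>k\<close>.\<close>

definition Gamma :: "real ^ 'k \<Rightarrow> 'x measure set" where
  "Gamma \<tau> = {P \<in> dists. integrable P t \<and> (\<integral>x. t x \<partial>P) = \<tau>}"

text \<open>For empty \<open>Gamma \<tau>\<close> the supremum is \<open>-\<infinity>\<close>, the bottom element of \<open>ereal\<close>.\<close>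

definition specific_entropy :: "real ^ 'k \<Rightarrow> ereal" where
  "specific_entropy \<tau> = (SUP P\<in>Gamma \<tau>. entropy P)"

definition entropy_domain :: "(real ^ 'k) set" where
  "entropy_domain = {\<tau>. specific_entropy \<tau> > -\<infinity>}"

definition dists_star :: "'x measure set" where
  "dists_star = {P \<in> dists. integrable P t \<and> (\<integral>x. t x \<partial>P) \<in> entropy_domain}"

definition saddle_point :: "real ^ 'k \<Rightarrow> 'x measure \<Rightarrow> 'a measure \<Rightarrow> bool" where
  "saddle_point \<tau> P\<^sub>\<tau> \<zeta>\<^sub>\<tau> \<longleftrightarrow>
     P\<^sub>\<tau> \<in> Gamma \<tau> \<and> \<zeta>\<^sub>\<tau> \<in> rand_acts \<and>
     \<bar>loss_rand P\<^sub>\<tau> \<zeta>\<^sub>\<tau>\<bar> \<noteq> \<infinity> \<and>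
     (\<forall>\<zeta>\<in>rand_acts. loss_rand P\<^sub>\<tau> \<zeta>\<^sub>\<tau> \<le> loss_rand P\<^sub>\<tau> \<zeta>) \<and>
     (\<forall>P\<in>Gamma \<tau>. loss_rand P\<^sub>\<tau> \<zeta>\<^sub>\<tau> \<ge> loss_rand P \<zeta>\<^sub>\<tau>)"

definition penalized_entropy :: "real ^ 'k \<Rightarrow> 'x measure \<Rightarrow> ereal" where
  "penalized_entropy \<beta> P = entropy P - ereal (\<beta> \<bullet> (\<integral>x. t x \<partial>P))"

text \<open>For \<open>\<zeta> \<in> rand_acts\<close> the expectation in \<open>loss_at_rand x \<zeta>\<close> is defined at every \<open>x\<close>,
  because the point mass at \<open>x\<close> belongs to \<open>dists\<close>.\<close>

definition regular :: "real ^ 'k \<Rightarrow> bool" where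
  "regular \<tau> \<longleftrightarrow> \<tau> \<in> entropy_domain \<and>
     (\<exists>P\<^sub>\<tau> \<zeta>\<^sub>\<tau> \<beta>. saddle_point \<tau> P\<^sub>\<tau> \<zeta>\<^sub>\<tau> \<and>
        P\<^sub>\<tau> \<in> dists_star \<and>
        penalized_entropy \<beta> P\<^sub>\<tau> = (SUP P\<in>dists_star. penalized_entropy \<beta> P) \<and>
        \<bar>SUP P\<in>dists_star. penalized_entropy \<beta> P\<bar> \<noteq> \<infinity> \<and>
        (let \<beta>\<^sub>0 = specific_entropy \<tau> - ereal (\<beta> \<bullet> \<tau>)
         in AE x in P\<^sub>\<tau>. loss_at_rand x \<zeta>\<^sub>\<tau> = \<beta>\<^sub>0 + ereal (\<beta> \<bullet> t x)))"

end

end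

theory Submission
  imports Defs
begin

text \<open>
  Supporting the concave function \<open>h\<close> at \<open>\<tau>\<close> would give condition (i) but not condition (ii).
  Instead one supports the supremum \<open>k(\<sigma>)\<close> of \<open>L(P, \<zeta>\<^sub>\<tau>)\<close> over those \<open>P \<in> \<Gamma>\<^sub>\<sigma>\<close> with \<open>L(P, a) > -\<infinity>\<close> for all
  \<open>a\<close>. It is concave on the entropy domain and satisfies \<open>h \<le> k\<close>, with equality at \<open>\<tau>\<close>
  because of the saddle point. A slope \<open>\<beta>\<close> of \<open>k\<close> at the relative interior point \<open>\<tau>\<close> yields
  \<open>H(P) \<le> L(P, \<zeta>\<^sub>\<tau>) \<le> h(\<tau>) + \<beta>\<^sup>T(E\<^sub>P T - \<tau>)\<close>, which is (i). For the point mass at \<open>x\<close>, whose mean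
  \<open>t(x)\<close> lies in the entropy domain by assumption, it reads \<open>L(x, \<zeta>\<^sub>\<tau>) \<le> \<beta>\<^sub>0 + \<beta>\<^sup>T t(x)\<close>; both sides have the
  same \<open>P\<^sub>\<tau>\<close>-expectation, so they agree \<open>P\<^sub>\<tau>\<close>-almost surely, which is (ii).
\<close>

section \<open>Arithmetic of extended expectations\<close>

text \<open>Moving the negative part and the constant across removes every subtraction; at least one
  of \<open>ennreal c\<close> and \<open>ennreal (- c)\<close> is zero. An inequality between sums
  in \<open>ennreal\<close> can then be integrated over acts by monotonicity alone.\<close>

lemma le_ext_expectation_iff:
  assumes "ext_expectation_defined M f"
  shows "ereal c \<le> ext_expectation M f \<longleftrightarrow>
    (\<integral>\<^sup>+ x. e2ennreal (- f x) \<partial>M) + ennreal c \<le> (\<integral>\<^sup>+ x. e2ennreal (f x) \<partial>M) + ennreal (- c)"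
proof (cases "\<integral>\<^sup>+ x. e2ennreal (f x) \<partial>M" "\<integral>\<^sup>+ x. e2ennreal (- f x) \<partial>M" rule: ennreal2_cases)
  case (real_real p n)
  then show ?thesis
    by (cases "0 \<le> c")
      (auto simp: ext_expectation_def enn2ereal_ennreal ennreal_neg simp flip: ennreal_plus)
qed (use assms in \<open>auto simp: ext_expectation_def ext_expectation_defined_def enn2ereal_ennreal top_unique\<close>)

text \<open>Definedness matters: with both parts infinite, \<open>ext_expectation\<close> takes the
  value \<open>\<infinity> - \<infinity> = \<infinity>\<close> although the negative part is
  infinite.\<close>

lemma ext_expectation_gt_MInfty_iff:
  assumes "ext_expectation_defined M f"
  shows "-\<infinity> < ext_expectation M f \<longleftrightarrow> (\<integral>\<^sup>+ x. e2ennreal (- f x) \<partial>M) < \<infinity>"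
  using assms
  by (cases "\<integral>\<^sup>+ x. e2ennreal (f x) \<partial>M" "\<integral>\<^sup>+ x. e2ennreal (- f x) \<partial>M" rule: ennreal2_cases)
    (auto simp: ext_expectation_def ext_expectation_defined_def enn2ereal_ennreal)

text \<open>The assumption \<open>mix\<close> ranges over all Borel \<open>s\<close>, so that the
  identity and \<open>uminus\<close> give both parts of \<open>f\<close>. Finite negative parts
  exclude a sum of opposite infinities, so the subtraction distributes over the weights.\<close>

lemma ext_expectation_convex_combination:
  fixes u :: real
  assumes u: "0 < u" "u < 1"
    and mix: "\<And>s :: ereal \<Rightarrow> ereal. s \<in> borel_measurable borel \<Longrightarrow>
      (\<integral>\<^sup>+ x. e2ennreal (s (f x)) \<partial>M) =
        ennreal u * (\<integral>\<^sup>+ x. e2ennreal (s (f x)) \<partial>M1) + ennreal (1 - u) * (\<integral>\<^sup>+ x. e2ennreal (s (f x)) \<partial>M2)"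
    and M1: "(\<integral>\<^sup>+ x. e2ennreal (- f x) \<partial>M1) < \<infinity>"
    and M2: "(\<integral>\<^sup>+ x. e2ennreal (- f x) \<partial>M2) < \<infinity>"
  shows "ext_expectation M f = ereal u * ext_expectation M1 f + ereal (1 - u) * ext_expectation M2 f"
proof -
  have pos: "(\<integral>\<^sup>+ x. e2ennreal (f x) \<partial>M) = ennreal u * (\<integral>\<^sup>+ x. e2ennreal (f x) \<partial>M1)
      + ennreal (1 - u) * (\<integral>\<^sup>+ x. e2ennreal (f x) \<partial>M2)"
    using mix[of "\<lambda>x. x"] by simp
  have neg: "(\<integral>\<^sup>+ x. e2ennreal (- f x) \<partial>M) = ennreal u * (\<integral>\<^sup>+ x. e2ennreal (- f x) \<partial>M1)
      + ennreal (1 - u) * (\<integral>\<^sup>+ x. e2ennreal (- f x) \<partial>M2)"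
    using mix[of uminus] by simp
  obtain n1 n2 where n: "0 \<le> n1" "0 \<le> n2"
      "(\<integral>\<^sup>+ x. e2ennreal (- f x) \<partial>M1) = ennreal n1" "(\<integral>\<^sup>+ x. e2ennreal (- f x) \<partial>M2) = ennreal n2"
    using M1 M2 by (metis ennreal_cases infinity_ennreal_def less_irrefl)
  have neg': "(\<integral>\<^sup>+ x. e2ennreal (- f x) \<partial>M) = ennreal (u * n1 + (1 - u) * n2)"
    using u n by (simp add: neg ennreal_mult' ennreal_plus)
  have nn: "0 \<le> u * n1 + (1 - u) * n2" using u n by simp
  show ?thesis
    using u n nn
  proof (cases "\<integral>\<^sup>+ x. e2ennreal (f x) \<partial>M1" "\<integral>\<^sup>+ x. e2ennreal (f x) \<partial>M2" rule: ennreal2_cases)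
    case (real_real p1 p2)
    have "(\<integral>\<^sup>+ x. e2ennreal (f x) \<partial>M) = ennreal (u * p1 + (1 - u) * p2)"
      using u real_real by (simp add: pos ennreal_mult' ennreal_plus)
    moreover have "0 \<le> u * p1 + (1 - u) * p2" using u real_real by simp
    ultimately show ?thesis
      using n nn real_real u
      by (simp add: ext_expectation_def neg' enn2ereal_ennreal algebra_simps)
  qed (auto simp: ext_expectation_def pos neg' enn2ereal_ennreal ennreal_mult_top ennreal_top_mult
        ennreal_mult_eq_top_iff)
qed

section \<open>Mixtures of two probability measures\<close>

text \<open>A biased coin chooses the component. Written as a monadic bind, the mixture gets its
  integrals from \<open>nn_integral_bind\<close>.\<close>

definition mixture :: "real \<Rightarrow> 'c measure \<Rightarrow> 'c measure \<Rightarrow> 'c measure" where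
  "mixture u P Q = measure_pmf (bernoulli_pmf u) \<bind> (\<lambda>b. if b then P else Q)"

context
  fixes M P Q :: "'c measure" and u :: real
  assumes P: "prob_space P" "sets P = sets M"
    and Q: "prob_space Q" "sets Q = sets M"
    and u: "0 \<le> u" "u \<le> 1"
begin

lemma mixture_kernel:
  "(\<lambda>b. if b then P else Q) \<in> measurable (measure_pmf (bernoulli_pmf u)) (subprob_algebra M)"
  using P Q by (auto simp: space_subprob_algebra prob_space_imp_subprob_space)

lemma sets_mixture: "sets (mixture u P Q) = sets M"
  unfolding mixture_def by (rule sets_bind) (use P Q in auto)

lemma nn_integral_mixture:
  assumes "f \<in> borel_measurable M"
  shows "(\<integral>\<^sup>+ x. f x \<partial>mixture u P Q) = ennreal u * (\<integral>\<^sup>+ x. f x \<partial>P) + ennreal (1 - u) * (\<integral>\<^sup>+ x. f x \<partial>Q)"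
  unfolding mixture_def
  by (subst nn_integral_bind[OF assms mixture_kernel])
     (use u in \<open>simp add: mult.commute\<close>)

lemma prob_space_mixture: "prob_space (mixture u P Q)"
proof
  have "emeasure (mixture u P Q) (space (mixture u P Q)) = (\<integral>\<^sup>+ x. 1 \<partial>mixture u P Q)"
    by simp
  also have "\<dots> = ennreal u + ennreal (1 - u)"
    by (subst nn_integral_mixture) (use P Q in \<open>auto simp: prob_space.emeasure_space_1\<close>)
  finally show "emeasure (mixture u P Q) (space (mixture u P Q)) = 1"
    using u by (simp flip: ennreal_plus)
qed

text \<open>Real functions are split into positive and negative parts, where
  \<open>nn_integral_mixture\<close> applies; vectors are treated coordinatewise.\<close>

lemma integral_mixture:
  fixes f :: "'c \<Rightarrow> 'b :: euclidean_space"
  assumes "integrable P f" "integrable Q f"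
  shows integrable_mixture: "integrable (mixture u P Q) f"
    and "(\<integral>x. f x \<partial>mixture u P Q) = u *\<^sub>R (\<integral>x. f x \<partial>P) + (1 - u) *\<^sub>R (\<integral>x. f x \<partial>Q)"
proof -
  have meas: "f \<in> borel_measurable M"
    using assms(1) P(2) by (auto simp: measurable_cong_sets[OF P(2) refl] dest!: borel_measurable_integrable)
  have "f \<in> borel_measurable (mixture u P Q)"
    using meas by (simp add: measurable_cong_sets[OF sets_mixture refl])
  moreover have "(\<integral>\<^sup>+ x. norm (f x) \<partial>mixture u P Q) < \<infinity>"
    by (subst nn_integral_mixture)
      (use assms meas in \<open>auto simp: integrable_iff_bounded ennreal_mult_less_top\<close>)
  ultimately show int: "integrable (mixture u P Q) f"
    by (simp add: integrable_iff_bounded)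
  have real: "(\<integral>x. g x \<partial>mixture u P Q) = u * (\<integral>x. g x \<partial>P) + (1 - u) * (\<integral>x. g x \<partial>Q)"
    if g: "integrable (mixture u P Q) g" "integrable P g" "integrable Q g" "g \<in> borel_measurable M" for g :: "'c \<Rightarrow> real"
  proof -
    \<comment> \<open>Since \<open>ennreal\<close> truncates negative values to 0,
      \<open>h = g\<close> and \<open>h = - g\<close> give the two parts of
      \<open>g\<close>.\<close>
    have *: "enn2real (\<integral>\<^sup>+ x. ennreal (h x) \<partial>mixture u P Q) =
        u * enn2real (\<integral>\<^sup>+ x. ennreal (h x) \<partial>P) + (1 - u) * enn2real (\<integral>\<^sup>+ x. ennreal (h x) \<partial>Q)"
      if "h \<in> borel_measurable M" "integrable P h" "integrable Q h" for h
      using that u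
      by (subst nn_integral_mixture)
        (auto simp: real_integrable_def enn2real_plus enn2real_mult ennreal_mult_less_top top.not_eq_extremum)
    show ?thesis
      using *[of g] *[of "\<lambda>x. - g x"] g by (simp add: real_lebesgue_integral_def algebra_simps)
  qed
  show "(\<integral>x. f x \<partial>mixture u P Q) = u *\<^sub>R (\<integral>x. f x \<partial>P) + (1 - u) *\<^sub>R (\<integral>x. f x \<partial>Q)"
  proof (rule euclidean_eqI)
    fix b :: 'b assume "b \<in> Basis"
    show "(\<integral>x. f x \<partial>mixture u P Q) \<bullet> b = (u *\<^sub>R (\<integral>x. f x \<partial>P) + (1 - u) *\<^sub>R (\<integral>x. f x \<partial>Q)) \<bullet> b"
      using assms int meas real[of "\<lambda>x. f x \<bullet> b"]
      by (simp add: inner_left_distrib flip: integral_inner_left)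
  qed
qed

lemma nn_integral_mixture_pair:
  assumes N: "prob_space N" and f: "f \<in> borel_measurable (M \<Otimes>\<^sub>M N)"
  shows "(\<integral>\<^sup>+ z. f z \<partial>(mixture u P Q \<Otimes>\<^sub>M N)) =
    ennreal u * (\<integral>\<^sup>+ z. f z \<partial>(P \<Otimes>\<^sub>M N)) + ennreal (1 - u) * (\<integral>\<^sup>+ z. f z \<partial>(Q \<Otimes>\<^sub>M N))"
proof -
  interpret N: prob_space N by fact
  have *: "(\<integral>\<^sup>+ z. f z \<partial>(R \<Otimes>\<^sub>M N)) = (\<integral>\<^sup>+ x. \<integral>\<^sup>+ y. f (x, y) \<partial>N \<partial>R)" if "sets R = sets M" for R
    by (rule N.nn_integral_fst[symmetric])
      (use f in \<open>simp add: measurable_cong_sets[OF sets_pair_measure_cong[OF that refl] refl]\<close>)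
  show ?thesis
    using N.borel_measurable_nn_integral_fst[OF f]
    by (simp add: *[OF sets_mixture] *[OF P(2)] *[OF Q(2)] nn_integral_mixture)
qed

end

section \<open>Supporting slopes at relative interior points\<close>

text \<open>Being topmost in its fibre puts \<open>(\<tau>, c)\<close> on the relative boundary of
  \<open>C\<close>, which yields a supporting hyperplane. It is not vertical because
  \<open>\<tau>\<close> is relatively interior to the projection, so it is the graph of an affine
  function.\<close>

lemma rel_interior_supporting_slope:
  fixes C :: "('a :: euclidean_space \<times> real) set"
  assumes C: "convex C"
    and down: "\<And>\<sigma> r s. (\<sigma>, r) \<in> C \<Longrightarrow> s \<le> r \<Longrightarrow> (\<sigma>, s) \<in> C"
    and ri: "\<tau> \<in> rel_interior (fst ` C)"
    and top: "(\<tau>, c) \<in> C" "\<And>r. (\<tau>, r) \<in> C \<Longrightarrow> r \<le> c"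
  obtains b where "\<And>\<sigma> r. (\<sigma>, r) \<in> C \<Longrightarrow> r \<le> c + b \<bullet> (\<sigma> - \<tau>)"
proof -
  have conv: "convex (fst ` C)" using C by (simp add: convex_linear_image linear_fst)
  \<comment> \<open>Otherwise the segment from \<open>(\<tau>, c - 1)\<close> to
    \<open>(\<tau>, c)\<close> could be prolonged inside \<open>C\<close>, to a height above
    \<open>c\<close>.\<close>
  have "(\<tau>, c) \<notin> rel_interior C"
  proof
    assume "(\<tau>, c) \<in> rel_interior C"
    moreover have "(\<tau>, c - 1) \<in> affine hull C"
      using down[OF top(1)] by (simp add: hull_inc)
    ultimately obtain m where m: "m > 1" "(1 - m) *\<^sub>R (\<tau>, c - 1) + m *\<^sub>R (\<tau>, c) \<in> C"
      using convex_rel_interior_if[OF C] by (meson order_refl)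
    have "(1 - m) *\<^sub>R (\<tau>, c - 1) + m *\<^sub>R (\<tau>, c) = (\<tau>, c + (m - 1))"
      by (simp add: algebra_simps flip: scaleR_add_left)
    with m top(2) show False by fastforce
  qed
  then obtain a where a: "\<And>y. y \<in> C \<Longrightarrow> a \<bullet> (\<tau>, c) \<le> a \<bullet> y"
      "\<And>y. y \<in> rel_interior C \<Longrightarrow> a \<bullet> (\<tau>, c) < a \<bullet> y"
    using supporting_hyperplane_rel_boundary[OF C top(1)] by metis
  obtain w v where av: "a = (w, v)" by (cases a)
  have "v \<le> 0" using a(1)[OF down[OF top(1), of "c - 1"]] by (simp add: av algebra_simps)
  moreover have "v \<noteq> 0"
  \<comment> \<open>A vertical hyperplane would bound the projection by \<open>w\<close> at
    \<open>\<tau>\<close>. Prolonging a segment from \<open>\<sigma>\<close> beyond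
    \<open>\<tau>\<close> reverses the strict inequality that holds at
    \<open>\<sigma>\<close>.\<close>
  proof
    assume v: "v = 0"
    have "rel_interior C \<noteq> {}" using C top(1) rel_interior_eq_empty by blast
    then obtain \<sigma> r where y: "(\<sigma>, r) \<in> rel_interior C" by auto
    then have "(\<sigma>, r) \<in> C" using rel_interior_subset by blast
    then have "\<sigma> \<in> affine hull (fst ` C)" by (force intro: hull_inc)
    then obtain m where m: "m > 1" "(1 - m) *\<^sub>R \<sigma> + m *\<^sub>R \<tau> \<in> fst ` C"
      using convex_rel_interior_if[OF conv ri] by (meson order_refl)
    then obtain s where "((1 - m) *\<^sub>R \<sigma> + m *\<^sub>R \<tau>, s) \<in> C" by auto
    from a(1)[OF this] have "(m - 1) * (w \<bullet> \<sigma>) \<le> (m - 1) * (w \<bullet> \<tau>)"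
      by (simp add: av v inner_right_distrib algebra_simps)
    moreover have "w \<bullet> \<tau> < w \<bullet> \<sigma>" using a(2)[OF y] by (simp add: av v)
    ultimately show False using m(1) by simp
  qed
  ultimately have v: "v < 0" by simp
  show ?thesis
  proof (rule that[of "(- 1 / v) *\<^sub>R w"])
    fix \<sigma> r assume "(\<sigma>, r) \<in> C"
    from a(1)[OF this] have "w \<bullet> \<tau> + v * c \<le> w \<bullet> \<sigma> + v * r" by (simp add: av)
    with v show "r \<le> c + ((- 1 / v) *\<^sub>R w) \<bullet> (\<sigma> - \<tau>)"
      by (simp add: field_simps inner_diff_right)
  qed
qed

section \<open>Losses, entropy and point masses in a basic game\<close>

context basic_game
begin

lemma loss_pair_measurable:
  assumes "sets P = sets X" "sets \<zeta> = sets A"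
  shows "(\<lambda>(x, a). L x a) \<in> borel_measurable (P \<Otimes>\<^sub>M \<zeta>)"
  using loss_measurable by (simp add: measurable_cong_sets[OF sets_pair_measure_cong[OF assms] refl])

lemma loss_section_measurable:
  assumes "sets P = sets X" "a \<in> space A"
  shows "(\<lambda>x. L x a) \<in> borel_measurable P"
proof -
  have "(\<lambda>x. (x, a)) \<in> measurable P (P \<Otimes>\<^sub>M A)" using assms(2) by measurable
  from measurable_compose[OF this loss_pair_measurable[OF assms(1) refl]] show ?thesis by simp
qed

text \<open>Finite negative parts survive mixing. Without them, a component with loss
  \<open>\<infinity>\<close> and one with loss \<open>-\<infinity>\<close> could make the loss of
  the mixture undefined.\<close>

lemma dists_mixture:
  assumes "P \<in> dists" "\<And>a. a \<in> space A \<Longrightarrow> -\<infinity> < loss_act P a"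
    and "Q \<in> dists" "\<And>a. a \<in> space A \<Longrightarrow> -\<infinity> < loss_act Q a"
    and u: "0 < u" "u < 1"
  shows "mixture u P Q \<in> dists"
    and "a \<in> space A \<Longrightarrow> loss_act (mixture u P Q) a = ereal u * loss_act P a + ereal (1 - u) * loss_act Q a"
proof -
  have PQ: "prob_space P" "sets P = sets X" "prob_space Q" "sets Q = sets X"
    using assms by (auto simp: dists_def)
  have mix: "(\<integral>\<^sup>+ x. e2ennreal (s (L x a)) \<partial>mixture u P Q) =
      ennreal u * (\<integral>\<^sup>+ x. e2ennreal (s (L x a)) \<partial>P) + ennreal (1 - u) * (\<integral>\<^sup>+ x. e2ennreal (s (L x a)) \<partial>Q)"
    if "s \<in> borel_measurable borel" "a \<in> space A" for s :: "ereal \<Rightarrow> ereal" and a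
    using that u loss_section_measurable[OF refl that(2)]
    by (intro nn_integral_mixture[OF PQ]) (auto intro!: measurable_compose[of _ _ _ s])
  have neg: "(\<integral>\<^sup>+ x. e2ennreal (- L x a) \<partial>P) < \<infinity>" "(\<integral>\<^sup>+ x. e2ennreal (- L x a) \<partial>Q) < \<infinity>"
    if "a \<in> space A" for a
    using that assms
    by (auto simp: dists_def loss_act_def simp del: infinity_ennreal_def
        intro!: ext_expectation_gt_MInfty_iff[THEN iffD1])
  have "(\<integral>\<^sup>+ x. e2ennreal (- L x a) \<partial>mixture u P Q) < \<infinity>" if "a \<in> space A" for a
    using mix[of uminus a] neg[OF that] that by (simp add: ennreal_mult_less_top)
  then have "\<forall>a\<in>space A. (\<integral>\<^sup>+ x. e2ennreal (- L x a) \<partial>mixture u P Q) \<noteq> \<infinity>"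
    by (metis less_irrefl)
  then show "mixture u P Q \<in> dists"
    using u by (auto simp: dists_def ext_expectation_defined_def prob_space_mixture[OF PQ] sets_mixture[OF PQ])
  show "loss_act (mixture u P Q) a = ereal u * loss_act P a + ereal (1 - u) * loss_act Q a"
    if "a \<in> space A"
    unfolding loss_act_def using mix neg that by (intro ext_expectation_convex_combination u) auto
qed

lemma loss_rand_mixture:
  assumes "P \<in> dists" "Q \<in> dists" "\<zeta> \<in> rand_acts"
    and "-\<infinity> < loss_rand P \<zeta>" "-\<infinity> < loss_rand Q \<zeta>"
    and u: "0 < u" "u < 1"
  shows "loss_rand (mixture u P Q) \<zeta> = ereal u * loss_rand P \<zeta> + ereal (1 - u) * loss_rand Q \<zeta>"
proof -
  have PQ: "prob_space P" "sets P = sets X" "prob_space Q" "sets Q = sets X"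
    and \<zeta>: "prob_space \<zeta>" "sets \<zeta> = sets A"
    using assms by (auto simp: dists_def rand_acts_def)
  have mix: "(\<integral>\<^sup>+ z. e2ennreal (s (case z of (x, a) \<Rightarrow> L x a)) \<partial>(mixture u P Q \<Otimes>\<^sub>M \<zeta>)) =
      ennreal u * (\<integral>\<^sup>+ z. e2ennreal (s (case z of (x, a) \<Rightarrow> L x a)) \<partial>(P \<Otimes>\<^sub>M \<zeta>)) +
      ennreal (1 - u) * (\<integral>\<^sup>+ z. e2ennreal (s (case z of (x, a) \<Rightarrow> L x a)) \<partial>(Q \<Otimes>\<^sub>M \<zeta>))"
    if "s \<in> borel_measurable borel" for s :: "ereal \<Rightarrow> ereal"
    using that u loss_pair_measurable[OF refl \<zeta>(2)]
    by (intro nn_integral_mixture_pair[OF PQ _ _ \<zeta>(1)])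
      (auto intro!: measurable_compose[of _ _ _ e2ennreal] measurable_compose[of _ _ _ s])
  show ?thesis
    unfolding loss_rand_def
    by (rule ext_expectation_convex_combination[OF u mix])
      (use assms in \<open>auto simp: rand_acts_def loss_rand_def simp del: infinity_ennreal_def
        intro!: ext_expectation_gt_MInfty_iff[THEN iffD1]\<close>)
qed

text \<open>An average over acts cannot fall below the infimum. Since the losses may be infinite,
  the averaging is done on the subtraction-free form of the inequality, for a real \<open>c\<close>
  strictly between the two sides.\<close>

lemma entropy_le_loss_rand:
  assumes P: "P \<in> dists" and \<zeta>: "\<zeta> \<in> rand_acts"
  shows "entropy P \<le> loss_rand P \<zeta>"
proof (rule ccontr)
  interpret P: prob_space P using P by (simp add: dists_def)
  interpret Z: prob_space \<zeta> using \<zeta> by (simp add: rand_acts_def)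
  interpret pair_sigma_finite P \<zeta> ..
  have sets: "sets P = sets X" "sets \<zeta> = sets A"
    using P \<zeta> by (auto simp: dists_def rand_acts_def)
  note meas = loss_pair_measurable[OF sets]
  have Lpos: "(\<lambda>z. e2ennreal (case z of (x, a) \<Rightarrow> L x a)) \<in> borel_measurable (P \<Otimes>\<^sub>M \<zeta>)"
    and Lneg: "(\<lambda>z. e2ennreal (- (case z of (x, a) \<Rightarrow> L x a))) \<in> borel_measurable (P \<Otimes>\<^sub>M \<zeta>)"
    using meas by (auto intro!: measurable_compose[of _ _ _ e2ennreal])
  \<comment> \<open>The constant may enter the integral over \<open>\<zeta>\<close> because
    \<open>\<zeta>\<close> has total mass 1.\<close>
  have fubini: "(\<integral>\<^sup>+ z. f z \<partial>(P \<Otimes>\<^sub>M \<zeta>)) + ennreal c = (\<integral>\<^sup>+ a. (\<integral>\<^sup>+ x. f (x, a) \<partial>P) + ennreal c \<partial>\<zeta>)"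
    if "f \<in> borel_measurable (P \<Otimes>\<^sub>M \<zeta>)" for f c
    using that by (subst nn_integral_add) (auto simp: nn_integral_snd Z.emeasure_space_1)
  assume "\<not> entropy P \<le> loss_rand P \<zeta>"
  then obtain c where c: "loss_rand P \<zeta> < ereal c" "ereal c < entropy P"
    using ereal_dense2 by (meson not_le)
  have "(\<integral>\<^sup>+ z. e2ennreal (- (case z of (x, a) \<Rightarrow> L x a)) \<partial>(P \<Otimes>\<^sub>M \<zeta>)) + ennreal c
      \<le> (\<integral>\<^sup>+ z. e2ennreal (case z of (x, a) \<Rightarrow> L x a) \<partial>(P \<Otimes>\<^sub>M \<zeta>)) + ennreal (- c)"
    unfolding fubini[OF Lpos] fubini[OF Lneg]
  proof (rule nn_integral_mono)
    fix a assume "a \<in> space \<zeta>"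
    then have a: "a \<in> space A" using sets_eq_imp_space_eq[OF sets(2)] by simp
    then have "ereal c \<le> ext_expectation P (\<lambda>x. L x a)"
      using c(2) INF_lower[of a "space A" "loss_act P"] by (simp add: entropy_def loss_act_def)
    then show "(\<integral>\<^sup>+ x. e2ennreal (- (case (x, a) of (x, a) \<Rightarrow> L x a)) \<partial>P) + ennreal c
        \<le> (\<integral>\<^sup>+ x. e2ennreal (case (x, a) of (x, a) \<Rightarrow> L x a) \<partial>P) + ennreal (- c)"
      using P a by (simp add: dists_def le_ext_expectation_iff)
  qed
  then have "ereal c \<le> loss_rand P \<zeta>"
    using P \<zeta> by (simp add: loss_rand_def rand_acts_def le_ext_expectation_iff)
  with c(1) show False by simp
qed

text \<open>Embedding pure acts as point masses lets the minimality of a saddle-point over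
  randomized acts be compared with \<open>entropy\<close>.\<close>

lemma return_rand_acts:
  assumes a: "a \<in> space A"
  shows "return A a \<in> rand_acts" and "P \<in> dists \<Longrightarrow> loss_rand P (return A a) = loss_act P a"
proof -
  interpret R: prob_space "return A a" using a by (rule prob_space_return)
  have *: "(\<integral>\<^sup>+ z. e2ennreal (s (case z of (x, a) \<Rightarrow> L x a)) \<partial>(P \<Otimes>\<^sub>M return A a)) =
      (\<integral>\<^sup>+ x. e2ennreal (s (L x a)) \<partial>P)"
    if "s \<in> borel_measurable borel" "P \<in> dists" for s :: "ereal \<Rightarrow> ereal" and P
  proof -
    have meas: "(\<lambda>z. e2ennreal (s (case z of (x, a) \<Rightarrow> L x a))) \<in> borel_measurable (P \<Otimes>\<^sub>M A)"
      using that loss_pair_measurable[of P A]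
      by (auto simp: dists_def intro!: measurable_compose[of _ _ _ e2ennreal] measurable_compose[of _ _ _ s])
    have "(\<integral>\<^sup>+ z. e2ennreal (s (case z of (x, a) \<Rightarrow> L x a)) \<partial>(P \<Otimes>\<^sub>M return A a)) =
        (\<integral>\<^sup>+ x. \<integral>\<^sup>+ a. e2ennreal (s (L x a)) \<partial>return A a \<partial>P)"
      using meas by (subst R.nn_integral_fst[symmetric])
        (auto simp: measurable_cong_sets[OF sets_pair_measure_cong[OF refl sets_return] refl])
    also have "\<dots> = (\<integral>\<^sup>+ x. e2ennreal (s (L x a)) \<partial>P)"
    proof (rule nn_integral_cong)
      fix x assume "x \<in> space P"
      then have "(\<lambda>a. (x, a)) \<in> measurable A (P \<Otimes>\<^sub>M A)" by measurable
      from measurable_compose[OF this meas] a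
      show "(\<integral>\<^sup>+ a. e2ennreal (s (L x a)) \<partial>return A a) = e2ennreal (s (L x a))"
        by (simp add: nn_integral_return)
    qed
    finally show ?thesis .
  qed
  show "return A a \<in> rand_acts"
    using a *[of "\<lambda>x. x"] *[of uminus]
    by (auto simp: rand_acts_def ext_expectation_defined_def R.prob_space_axioms dists_def)
  show "loss_rand P (return A a) = loss_act P a" if "P \<in> dists"
    using that *[of "\<lambda>x. x"] *[of uminus]
    by (simp add: loss_rand_def loss_act_def ext_expectation_def)
qed

text \<open>Point masses convert a bound on \<open>loss_rand\<close> over distributions into a
  pointwise bound on \<open>loss_at_rand\<close>. They belong to \<open>dists\<close> because a loss
  above \<open>-\<infinity>\<close> has a finite negative part.\<close>

lemma return_dists:
  assumes x: "x \<in> space X"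
  shows "return X x \<in> dists"
    and "a \<in> space A \<Longrightarrow> loss_act (return X x) a = L x a"
    and "\<zeta> \<in> rand_acts \<Longrightarrow> loss_rand (return X x) \<zeta> = loss_at_rand x \<zeta>"
proof -
  have *: "(\<integral>\<^sup>+ y. e2ennreal (s (L y a)) \<partial>return X x) = e2ennreal (s (L x a))"
    if "s \<in> borel_measurable borel" "a \<in> space A" for s :: "ereal \<Rightarrow> ereal" and a
    using that x loss_section_measurable[OF refl that(2)]
    by (subst nn_integral_return) (auto intro!: measurable_compose[of _ _ _ s])
  have L: "ext_expectation (return X x) (\<lambda>y. L y a) = L x a"
    if "a \<in> space A" for a
    using that *[of "\<lambda>x. x" a] *[of uminus a]
    by (cases "L x a"; cases "0 \<le> real_of_ereal (L x a)")
      (auto simp: ext_expectation_def e2ennreal_neg enn2ereal_ennreal ennreal_neg zero_ennreal.rep_eq)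
  show "return X x \<in> dists"
  proof -
    have "e2ennreal (- L x a) \<noteq> \<infinity>" if "a \<in> space A" for a
      using loss_gt_minus_infinity[OF x that] by (cases "L x a") (auto simp: e2ennreal_neg)
    then show ?thesis
      using x *[of uminus] by (auto simp: dists_def prob_space_return ext_expectation_defined_def)
  qed
  show "loss_act (return X x) a = L x a" if "a \<in> space A"
    using that L by (simp add: loss_act_def)
  show "loss_rand (return X x) \<zeta> = loss_at_rand x \<zeta>" if \<zeta>: "\<zeta> \<in> rand_acts"
  proof -
    interpret Z: prob_space \<zeta> using \<zeta> by (simp add: rand_acts_def)
    have sets: "sets \<zeta> = sets A" using \<zeta> by (simp add: rand_acts_def)
    have "(\<integral>\<^sup>+ z. e2ennreal (s (case z of (x, a) \<Rightarrow> L x a)) \<partial>(return X x \<Otimes>\<^sub>M \<zeta>)) =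
        (\<integral>\<^sup>+ a. e2ennreal (s (L x a)) \<partial>\<zeta>)"
      if "s \<in> borel_measurable borel" for s :: "ereal \<Rightarrow> ereal"
    proof -
      have meas: "(\<lambda>z. e2ennreal (s (case z of (x, a) \<Rightarrow> L x a))) \<in> borel_measurable (X \<Otimes>\<^sub>M \<zeta>)"
        using that loss_pair_measurable[OF refl sets]
        by (auto intro!: measurable_compose[of _ _ _ e2ennreal] measurable_compose[of _ _ _ s])
      have "(\<integral>\<^sup>+ z. e2ennreal (s (case z of (x, a) \<Rightarrow> L x a)) \<partial>(return X x \<Otimes>\<^sub>M \<zeta>)) =
          (\<integral>\<^sup>+ x. \<integral>\<^sup>+ a. e2ennreal (s (L x a)) \<partial>\<zeta> \<partial>return X x)"
        using meas by (subst Z.nn_integral_fst[symmetric])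
          (auto simp: measurable_cong_sets[OF sets_pair_measure_cong[OF sets_return refl] refl])
      also have "\<dots> = (\<integral>\<^sup>+ a. e2ennreal (s (L x a)) \<partial>\<zeta>)"
        using x Z.borel_measurable_nn_integral_fst[OF meas] by (subst nn_integral_return) auto
      finally show ?thesis .
    qed
    from this[of "\<lambda>x. x"] this[of uminus] show ?thesis
      by (simp add: loss_rand_def loss_at_rand_def ext_expectation_def)
  qed
qed

text \<open>The gap between \<open>g\<close> and the loss is nonnegative with integral zero, hence
  vanishes almost surely.\<close>

lemma AE_loss_at_rand_eq:
  assumes P: "P \<in> dists" and \<zeta>: "\<zeta> \<in> rand_acts"
    and g: "integrable P g" "loss_rand P \<zeta> = ereal (\<integral>x. g x \<partial>P)"
    and le: "\<And>x. x \<in> space X \<Longrightarrow> loss_at_rand x \<zeta> \<le> ereal (g x)"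
  shows "AE x in P. loss_at_rand x \<zeta> = ereal (g x)"
proof -
  interpret P: prob_space P using P by (simp add: dists_def)
  interpret Z: prob_space \<zeta> using \<zeta> by (simp add: rand_acts_def)
  have sets: "sets P = sets X" "sets \<zeta> = sets A"
    using P \<zeta> by (auto simp: dists_def rand_acts_def)
  have Lpos: "(\<lambda>z. e2ennreal (case z of (x, a) \<Rightarrow> L x a)) \<in> borel_measurable (P \<Otimes>\<^sub>M \<zeta>)"
    and Lneg: "(\<lambda>z. e2ennreal (- (case z of (x, a) \<Rightarrow> L x a))) \<in> borel_measurable (P \<Otimes>\<^sub>M \<zeta>)"
    using loss_pair_measurable[OF sets] by (auto intro!: measurable_compose[of _ _ _ e2ennreal])
  \<comment> \<open>These integrate the two parts of \<open>L x a\<close> over acts; both may be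
    positive at the same \<open>x\<close>, so they need not be the two parts of
    \<open>loss_at_rand x \<zeta>\<close>.\<close>
  define p n where "p x = (\<integral>\<^sup>+ a. e2ennreal (L x a) \<partial>\<zeta>)" and "n x = (\<integral>\<^sup>+ a. e2ennreal (- L x a) \<partial>\<zeta>)" for x
  have meas: "p \<in> borel_measurable P" "n \<in> borel_measurable P"
    using Z.borel_measurable_nn_integral_fst[OF Lpos] Z.borel_measurable_nn_integral_fst[OF Lneg]
    by (simp_all add: p_def[abs_def] n_def[abs_def])
  have int: "loss_rand P \<zeta> = enn2ereal (\<integral>\<^sup>+ x. p x \<partial>P) - enn2ereal (\<integral>\<^sup>+ x. n x \<partial>P)"
    using Z.nn_integral_fst[OF Lpos] Z.nn_integral_fst[OF Lneg]
    by (simp add: loss_rand_def ext_expectation_def p_def n_def)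
  \<comment> \<open>A finite difference in \<open>ereal\<close> forces both integrals to be
    finite.\<close>
  obtain c d where cd: "0 \<le> c" "0 \<le> d" "(\<integral>\<^sup>+ x. p x \<partial>P) = ennreal c" "(\<integral>\<^sup>+ x. n x \<partial>P) = ennreal d"
      "c - d = (\<integral>x. g x \<partial>P)"
    using int g(2)
    by (cases "\<integral>\<^sup>+ x. p x \<partial>P" "\<integral>\<^sup>+ x. n x \<partial>P" rule: ennreal2_cases) (auto simp: enn2ereal_ennreal)
  have real: "AE x in P. f x \<noteq> \<infinity>" "integrable P (\<lambda>x. enn2real (f x))" "(\<integral>x. enn2real (f x) \<partial>P) = e"
    if "f \<in> borel_measurable P" "(\<integral>\<^sup>+ x. f x \<partial>P) = ennreal e" "0 \<le> e" for f e
  proof -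
    show fin: "AE x in P. f x \<noteq> \<infinity>" by (rule nn_integral_PInf_AE) (use that in auto)
    have "(\<integral>\<^sup>+ x. ennreal (enn2real (f x)) \<partial>P) = (\<integral>\<^sup>+ x. f x \<partial>P)"
      by (rule nn_integral_cong_AE) (use fin in \<open>auto simp: less_top elim!: eventually_mono\<close>)
    then show "integrable P (\<lambda>x. enn2real (f x))" "(\<integral>x. enn2real (f x) \<partial>P) = e"
      using that nn_integral_eq_integrable[of "\<lambda>x. enn2real (f x)" P e] by auto
  qed
  note p = real[OF meas(1) cd(3,1)] and n = real[OF meas(2) cd(4,2)]
  \<comment> \<open>Off a null set both inner integrals are finite, so the extended difference is a
    difference of reals.\<close>
  have eq: "AE x in P. loss_at_rand x \<zeta> = ereal (enn2real (p x) - enn2real (n x))"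
    using p(1) n(1)
  proof eventually_elim
    case (elim x)
    then show ?case
      by (cases "p x" "n x" rule: ennreal2_cases)
        (auto simp: loss_at_rand_def ext_expectation_def p_def n_def enn2ereal_ennreal)
  qed
  have "AE x in P. 0 \<le> g x - (enn2real (p x) - enn2real (n x))"
    using eq AE_space
  proof eventually_elim
    case (elim x)
    then show ?case using le[of x] sets_eq_imp_space_eq[OF sets(1)] by simp
  qed
  moreover have "(\<integral>x. g x - (enn2real (p x) - enn2real (n x)) \<partial>P) = 0"
    using g(1) p n cd by simp
  ultimately have "AE x in P. g x - (enn2real (p x) - enn2real (n x)) = 0"
    using g(1) p n by (subst (asm) integral_nonneg_eq_0_iff_AE) auto
  with eq show ?thesis by eventually_elim simp
qed

lemma loss_act_gt_MInfty:
  assumes "-\<infinity> < entropy P" "a \<in> space A"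
  shows "-\<infinity> < loss_act P a"
  using assms INF_lower[of a "space A" "loss_act P"] by (auto simp: entropy_def intro: less_le_trans)

text \<open>Entropy is concave as an infimum of losses that are affine along the mixture.\<close>

lemma entropy_mixture:
  assumes "P \<in> dists" "-\<infinity> < entropy P" "Q \<in> dists" "-\<infinity> < entropy Q"
    and u: "0 < u" "u < 1"
  shows "ereal u * entropy P + ereal (1 - u) * entropy Q \<le> entropy (mixture u P Q)"
  unfolding entropy_def[of "mixture u P Q"]
proof (rule INF_greatest)
  fix a assume a: "a \<in> space A"
  show "ereal u * entropy P + ereal (1 - u) * entropy Q \<le> loss_act (mixture u P Q) a"
    using a u assms unfolding entropy_def
    by (subst dists_mixture(2))
      (auto intro!: add_mono ereal_mult_left_mono INF_lower loss_act_gt_MInfty simp del: ereal_infty_less simp: entropy_def)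
qed

end

section \<open>Mean constraints, the entropy domain and saddle-points\<close>

context basic_game_statistic
begin

lemma entropy_domain_iff: "\<sigma> \<in> entropy_domain \<longleftrightarrow> (\<exists>P\<in>Gamma \<sigma>. -\<infinity> < entropy P)"
  unfolding entropy_domain_def specific_entropy_def by (simp add: less_SUP_iff del: ereal_infty_less)

lemma Gamma_mixture:
  assumes "P \<in> Gamma \<sigma>" "\<And>a. a \<in> space A \<Longrightarrow> -\<infinity> < loss_act P a"
    and "Q \<in> Gamma \<rho>" "\<And>a. a \<in> space A \<Longrightarrow> -\<infinity> < loss_act Q a"
    and u: "0 < u" "u < 1"
  shows "mixture u P Q \<in> Gamma (u *\<^sub>R \<sigma> + (1 - u) *\<^sub>R \<rho>)"
proof -
  have PQ: "prob_space P" "sets P = sets X" "prob_space Q" "sets Q = sets X"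
    using assms by (auto simp: dists_def Gamma_def)
  show ?thesis
    using assms integrable_mixture[OF PQ, of u t] integral_mixture(2)[OF PQ, of u t]
    by (auto simp: Gamma_def simp del: ereal_infty_less intro!: dists_mixture)
qed

text \<open>Mixing witnesses of entropy above \<open>-\<infinity>\<close> gives such a witness at
  the intermediate mean. Open segments supply the weights strictly between 0 and 1 that the mixture
  lemmas require.\<close>

lemma convex_entropy_domain: "convex entropy_domain"
proof (unfold convex_contains_open_segment, intro ballI subsetI)
  fix \<sigma> \<rho> \<pi> assume "\<sigma> \<in> entropy_domain" "\<rho> \<in> entropy_domain" "\<pi> \<in> open_segment \<sigma> \<rho>"
  then obtain P Q u where
      P: "P \<in> Gamma \<sigma>" "-\<infinity> < entropy P" and Q: "Q \<in> Gamma \<rho>" "-\<infinity> < entropy Q"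
      and u: "0 < u" "u < 1" "\<pi> = (1 - u) *\<^sub>R \<sigma> + u *\<^sub>R \<rho>"
    unfolding entropy_domain_iff in_segment by blast
  have "-\<infinity> < ereal (1 - u) * entropy P + ereal u * entropy Q"
    using P Q u by (cases "entropy P"; cases "entropy Q") auto
  also have "\<dots> \<le> entropy (mixture (1 - u) P Q)"
    using entropy_mixture[of P Q "1 - u"] P Q u by (auto simp: Gamma_def)
  finally show "\<pi> \<in> entropy_domain"
    using Gamma_mixture[of P \<sigma> Q \<rho> "1 - u"] P Q u loss_act_gt_MInfty
    unfolding entropy_domain_iff by (intro bexI[of _ "mixture (1 - u) P Q"]) auto
qed

text \<open>This applies \<open>rel_interior_supporting_slope\<close> to the points lying below an
  attained loss against \<open>\<zeta>\<close>; \<open>max\<close> makes \<open>(\<tau>, c)\<close>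
  the top of its fibre.\<close>

lemma loss_rand_supporting_slope:
  assumes \<zeta>: "\<zeta> \<in> rand_acts"
    and \<tau>: "\<tau> \<in> rel_interior entropy_domain"
    and P: "P \<in> Gamma \<tau>" "-\<infinity> < entropy P" "loss_rand P \<zeta> = ereal c"
    and max: "\<And>Q. Q \<in> Gamma \<tau> \<Longrightarrow> loss_rand Q \<zeta> \<le> loss_rand P \<zeta>"
  obtains \<beta> where "\<And>\<sigma> Q. \<sigma> \<in> entropy_domain \<Longrightarrow> Q \<in> Gamma \<sigma> \<Longrightarrow>
    (\<And>a. a \<in> space A \<Longrightarrow> -\<infinity> < loss_act Q a) \<Longrightarrow> loss_rand Q \<zeta> \<le> ereal (c + \<beta> \<bullet> (\<sigma> - \<tau>))"
proof -
  \<comment> \<open>Distributions with \<open>L(Q, a) = -\<infinity>\<close> for some \<open>a\<close> are excluded, since \<open>dists\<close> is not closed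
    under their mixtures; requiring \<open>H(Q) > -\<infinity>\<close> would also exclude some of the point masses.\<close>
  define C where "C = {(\<sigma>, r). \<sigma> \<in> entropy_domain \<and>
    (\<exists>Q\<in>Gamma \<sigma>. (\<forall>a\<in>space A. -\<infinity> < loss_act Q a) \<and> ereal r \<le> loss_rand Q \<zeta>)}"
  have "convex C"
  proof (unfold convex_contains_open_segment, intro ballI subsetI)
    fix y z w assume "y \<in> C" "z \<in> C" "w \<in> open_segment y z"
    then obtain \<sigma> r Q \<rho> s R u where
        u: "0 < u" "u < 1" "w = (1 - u) *\<^sub>R (\<sigma>, r) + u *\<^sub>R (\<rho>, s)"
      and Q: "\<sigma> \<in> entropy_domain" "Q \<in> Gamma \<sigma>" "\<And>a. a \<in> space A \<Longrightarrow> -\<infinity> < loss_act Q a" "ereal r \<le> loss_rand Q \<zeta>"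
      and R: "\<rho> \<in> entropy_domain" "R \<in> Gamma \<rho>" "\<And>a. a \<in> space A \<Longrightarrow> -\<infinity> < loss_act R a" "ereal s \<le> loss_rand R \<zeta>"
      unfolding C_def in_segment by blast
    have mem: "Q \<in> dists" "R \<in> dists" using Q R by (auto simp: Gamma_def)
    have "(1 - u) *\<^sub>R \<sigma> + u *\<^sub>R \<rho> \<in> entropy_domain"
      using convexD[OF convex_entropy_domain Q(1) R(1), of "1 - u" u] u by simp
    moreover have "mixture (1 - u) Q R \<in> Gamma ((1 - u) *\<^sub>R \<sigma> + u *\<^sub>R \<rho>)"
      using Gamma_mixture[OF Q(2,3) R(2,3), of "1 - u"] u by simp
    moreover have "-\<infinity> < loss_act (mixture (1 - u) Q R) a" if a: "a \<in> space A" for a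
      using dists_mixture(2)[OF mem(1) Q(3) mem(2) R(3) _ _ a, of "1 - u"] u Q(3)[OF a] R(3)[OF a]
      by (cases "loss_act Q a"; cases "loss_act R a") auto
    moreover have "ereal ((1 - u) * r + u * s) \<le> loss_rand (mixture (1 - u) Q R) \<zeta>"
    proof -
      have "ereal (1 - u) * ereal r + ereal u * ereal s
          \<le> ereal (1 - u) * loss_rand Q \<zeta> + ereal u * loss_rand R \<zeta>"
        using Q(4) R(4) u by (intro add_mono ereal_mult_left_mono) auto
      also have "\<dots> = loss_rand (mixture (1 - u) Q R) \<zeta>"
      proof -
        \<comment> \<open>The real heights \<open>r\<close> and \<open>s\<close> below the two
          losses exclude \<open>-\<infinity>\<close>, as additivity along the mixture
          demands.\<close>
        have "-\<infinity> < loss_rand Q \<zeta>" "-\<infinity> < loss_rand R \<zeta>"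
          using Q(4) R(4) by (auto intro: less_le_trans[rotated] simp del: ereal_infty_less)
        then show ?thesis
          using loss_rand_mixture[OF mem \<zeta>, of "1 - u"] u by simp
      qed
      finally show ?thesis by simp
    qed
    ultimately show "w \<in> C" using u(3) by (auto simp: C_def)
  qed
  moreover have "(\<sigma>, r') \<in> C" if C: "(\<sigma>, r) \<in> C" and le: "r' \<le> r" for \<sigma> r r'
  proof -
    have "ereal r' \<le> v" if "ereal r \<le> v" for v
      using that le by (cases v) auto
    with C show ?thesis unfolding C_def by blast
  qed
  moreover have "fst ` C = entropy_domain"
  proof
    \<comment> \<open>A witness with entropy above \<open>-\<infinity>\<close> also has loss above
      \<open>-\<infinity>\<close> against \<open>\<zeta>\<close>, which leaves room for a real
      height.\<close>
    show "entropy_domain \<subseteq> fst ` C"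
    proof
      fix \<sigma> assume \<sigma>: "\<sigma> \<in> entropy_domain"
      then obtain Q where Q: "Q \<in> Gamma \<sigma>" "-\<infinity> < entropy Q" by (auto simp: entropy_domain_iff)
      then obtain r where "ereal r < entropy Q" using ereal_dense2 by blast
      also have "entropy Q \<le> loss_rand Q \<zeta>"
        using Q \<zeta> by (auto simp: Gamma_def intro: entropy_le_loss_rand)
      finally have "(\<sigma>, r) \<in> C"
        using \<sigma> Q loss_act_gt_MInfty[OF Q(2)] by (auto simp: C_def intro!: bexI[of _ Q])
      then show "\<sigma> \<in> fst ` C" by force
    qed
  qed (auto simp: C_def)
  moreover have "(\<tau>, c) \<in> C"
    using \<tau> rel_interior_subset P loss_act_gt_MInfty[OF P(2)] by (auto simp: C_def intro!: bexI[of _ P])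
  moreover have "r \<le> c" if "(\<tau>, r) \<in> C" for r
  proof -
    from that obtain Q where "Q \<in> Gamma \<tau>" "ereal r \<le> loss_rand Q \<zeta>" by (auto simp: C_def)
    then have "ereal r \<le> ereal c" using max P(3) by (metis order_trans)
    then show ?thesis by simp
  qed
  ultimately obtain \<beta> where \<beta>: "\<And>\<sigma> r. (\<sigma>, r) \<in> C \<Longrightarrow> r \<le> c + \<beta> \<bullet> (\<sigma> - \<tau>)"
    using rel_interior_supporting_slope[of C \<tau> c] \<tau> by metis
  show ?thesis
  \<comment> \<open>The loss might a priori be \<open>\<infinity>\<close>, so the real bound on
    \<open>C\<close> is contradicted at an intermediate real height.\<close>
  proof (rule that[of \<beta>], rule ccontr)
    fix \<sigma> Q assume Q: "\<sigma> \<in> entropy_domain" "Q \<in> Gamma \<sigma>" "\<And>a. a \<in> space A \<Longrightarrow> -\<infinity> < loss_act Q a"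
      and "\<not> loss_rand Q \<zeta> \<le> ereal (c + \<beta> \<bullet> (\<sigma> - \<tau>))"
    then obtain r where r: "ereal (c + \<beta> \<bullet> (\<sigma> - \<tau>)) < ereal r" "ereal r < loss_rand Q \<zeta>"
      using ereal_dense2 by (meson not_le)
    with Q have "(\<sigma>, r) \<in> C" by (auto simp: C_def intro!: bexI[of _ Q])
    from \<beta>[OF this] r(1) show False by simp
  qed
qed

text \<open>Minimality against point-mass acts gives one inequality for \<open>entropy P\<close>,
  averaging the other. For \<open>Q\<close> in \<open>Gamma \<tau>\<close>, \<open>entropy Q\<close>
  is at most \<open>loss_rand Q \<zeta>\<close> and hence at most the saddle value, which
  \<open>P\<close> attains.\<close>

lemma saddle_point_value:
  assumes "saddle_point \<tau> P \<zeta>"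
  shows "entropy P = loss_rand P \<zeta>" and "specific_entropy \<tau> = loss_rand P \<zeta>"
proof -
  have P: "P \<in> Gamma \<tau>" "P \<in> dists" and \<zeta>: "\<zeta> \<in> rand_acts"
    and min: "\<And>\<xi>. \<xi> \<in> rand_acts \<Longrightarrow> loss_rand P \<zeta> \<le> loss_rand P \<xi>"
    and max: "\<And>Q. Q \<in> Gamma \<tau> \<Longrightarrow> loss_rand Q \<zeta> \<le> loss_rand P \<zeta>"
    using assms by (auto simp: saddle_point_def Gamma_def)
  have "loss_rand P \<zeta> \<le> entropy P"
    unfolding entropy_def using min return_rand_acts P by (metis INF_greatest)
  with entropy_le_loss_rand[OF P(2) \<zeta>] show *: "entropy P = loss_rand P \<zeta>" by simp
  show "specific_entropy \<tau> = loss_rand P \<zeta>"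
    unfolding specific_entropy_def
  proof (rule antisym)
    show "(SUP P\<in>Gamma \<tau>. entropy P) \<le> loss_rand P \<zeta>"
    proof (rule SUP_least)
      fix Q assume "Q \<in> Gamma \<tau>"
      then show "entropy Q \<le> loss_rand P \<zeta>"
        using entropy_le_loss_rand[of Q \<zeta>] max[of Q] \<zeta> by (auto simp: Gamma_def)
    qed
    show "loss_rand P \<zeta> \<le> (SUP P\<in>Gamma \<tau>. entropy P)"
      using P(1) unfolding *[symmetric] by (rule SUP_upper)
  qed
qed

lemma rel_interior_saddle_point_regular:
  assumes \<tau>: "\<tau> \<in> rel_interior entropy_domain"
    and saddle: "saddle_point \<tau> P \<zeta>"
    and range: "\<And>x. x \<in> space X \<Longrightarrow> t x \<in> entropy_domain"
  shows "regular \<tau>"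
proof -
  have P: "P \<in> Gamma \<tau>" "P \<in> dists" "integrable P t" "(\<integral>x. t x \<partial>P) = \<tau>" and \<zeta>: "\<zeta> \<in> rand_acts"
    and max: "\<And>Q. Q \<in> Gamma \<tau> \<Longrightarrow> loss_rand Q \<zeta> \<le> loss_rand P \<zeta>"
    using saddle by (auto simp: saddle_point_def Gamma_def)
  interpret P: prob_space P using P by (simp add: dists_def)
  have \<tau>': "\<tau> \<in> entropy_domain" using \<tau> rel_interior_subset by blast
  obtain c where c: "loss_rand P \<zeta> = ereal c"
    using saddle by (auto simp: saddle_point_def)
  have val: "entropy P = ereal c" "specific_entropy \<tau> = ereal c"
    using saddle_point_value[OF saddle] c by auto
  obtain \<beta> where \<beta>: "\<And>\<sigma> Q. \<sigma> \<in> entropy_domain \<Longrightarrow> Q \<in> Gamma \<sigma> \<Longrightarrow>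
      (\<And>a. a \<in> space A \<Longrightarrow> -\<infinity> < loss_act Q a) \<Longrightarrow> loss_rand Q \<zeta> \<le> ereal (c + \<beta> \<bullet> (\<sigma> - \<tau>))"
    using loss_rand_supporting_slope[OF \<zeta> \<tau> P(1) _ c max] val(1) by auto
  have pen: "penalized_entropy \<beta> P = ereal (c - \<beta> \<bullet> \<tau>)"
    by (simp add: penalized_entropy_def val P)
  have star: "P \<in> dists_star" using P \<tau>' by (simp add: dists_star_def)
  have sup: "(SUP Q\<in>dists_star. penalized_entropy \<beta> Q) = ereal (c - \<beta> \<bullet> \<tau>)"
  proof (rule antisym)
    show "(SUP Q\<in>dists_star. penalized_entropy \<beta> Q) \<le> ereal (c - \<beta> \<bullet> \<tau>)"
    proof (rule SUP_least)
      fix Q assume "Q \<in> dists_star"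
      then have Q: "Q \<in> dists" "Q \<in> Gamma (\<integral>x. t x \<partial>Q)" "(\<integral>x. t x \<partial>Q) \<in> entropy_domain"
        by (auto simp: dists_star_def Gamma_def)
      \<comment> \<open>For entropy \<open>-\<infinity>\<close> the bound is trivial; otherwise
        every act has loss above \<open>-\<infinity>\<close>, so the slope bound applies to
        \<open>Q\<close>.\<close>
      have "entropy Q \<le> ereal (c + \<beta> \<bullet> ((\<integral>x. t x \<partial>Q) - \<tau>))"
      proof (cases "-\<infinity> < entropy Q")
        case True
        then show ?thesis
          using \<beta>[OF Q(3,2) loss_act_gt_MInfty] entropy_le_loss_rand[OF Q(1) \<zeta>] by (blast intro: order_trans)
      qed simp
      then show "penalized_entropy \<beta> Q \<le> ereal (c - \<beta> \<bullet> \<tau>)"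
        unfolding penalized_entropy_def
        by (cases "entropy Q") (auto simp: inner_diff_right)
    qed
    show "ereal (c - \<beta> \<bullet> \<tau>) \<le> (SUP Q\<in>dists_star. penalized_entropy \<beta> Q)"
      unfolding pen[symmetric] using star by (rule SUP_upper)
  qed
  have "loss_at_rand x \<zeta> \<le> ereal (c - \<beta> \<bullet> \<tau> + \<beta> \<bullet> t x)" if x: "x \<in> space X" for x
  proof -
    \<comment> \<open>The point mass has mean \<open>t x\<close>, which \<open>range\<close> places
      in the domain. Its entropy may be \<open>-\<infinity>\<close>, but each of its losses
      \<open>L x a\<close> exceeds \<open>-\<infinity>\<close>.\<close>
    have "return X x \<in> Gamma (t x)"
      using x return_dists(1)[OF x] statistic_measurable
      by (simp add: Gamma_def integral_return integrable_iff_bounded nn_integral_return)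
    then have "loss_rand (return X x) \<zeta> \<le> ereal (c + \<beta> \<bullet> (t x - \<tau>))"
      using x range by (intro \<beta>) (auto simp: return_dists loss_gt_minus_infinity simp del: ereal_infty_less)
    then show ?thesis
      by (simp add: return_dists(3)[OF x \<zeta>] inner_diff_right algebra_simps)
  qed
  \<comment> \<open>As \<open>P\<close> has mean \<open>\<tau>\<close>, the affine bound integrates
    to \<open>c\<close>, the saddle value, so the pointwise inequality becomes an almost sure
    equality.\<close>
  moreover have "integrable P (\<lambda>x. c - \<beta> \<bullet> \<tau> + \<beta> \<bullet> t x)" "(\<integral>x. c - \<beta> \<bullet> \<tau> + \<beta> \<bullet> t x \<partial>P) = c"
    using P by (auto simp: P.prob_space)
  ultimately have "AE x in P. loss_at_rand x \<zeta> = ereal (c - \<beta> \<bullet> \<tau> + \<beta> \<bullet> t x)"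
    using c by (intro AE_loss_at_rand_eq[OF P(2) \<zeta>]) auto
  then show ?thesis
    unfolding regular_def using \<tau>' saddle star pen sup val by (auto intro!: exI[of _ P] exI[of _ \<zeta>] exI[of _ \<beta>])
qed

end

theorem theorem7p2:
  fixes X :: "'x measure" and A :: "'a measure" and L :: "'x \<Rightarrow> 'a \<Rightarrow> ereal"
    and t :: "'x \<Rightarrow> real ^ 'k" and \<tau> :: "real ^ 'k"
    and P\<^sub>\<tau> :: "'x measure" and \<zeta>\<^sub>\<tau> :: "'a measure"
  assumes "basic_game_statistic X A L t"
    and "\<tau> \<in> rel_interior (basic_game_statistic.entropy_domain X A L t)"
    and "basic_game_statistic.saddle_point X A L t \<tau> P\<^sub>\<tau> \<zeta>\<^sub>\<tau>"
    and "\<forall>x\<in>space X. t x \<in> basic_game_statistic.entropy_domain X A L t"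
  shows "basic_game_statistic.regular X A L t \<tau>"
proof -
  interpret basic_game_statistic X A L t by fact
  show ?thesis using assms(2-4) by (auto intro: rel_interior_saddle_point_regular)
qed

end
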